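(* Over $\mathsf{RCA}_0$, the scheme $\mathsf{B}\boldsymbol\Sigma^0_2$ ($\Sigma^0_2$ bounding) is equivalent to the statement $\mathsf{FUF}$ (a finite union of finite sets is finite).
   Context: $\mathsf{RCA}_0$ is the usual base system of reverse mathematics, a theory in the language of second-order arithmetic: the axioms of discretely ordered semirings for $\mathbb{N}$, induction for $\Sigma^0_1$ formulas, and comprehension for $\Delta^0_1$ predicates (formulas may contain number and set parameters). $\mathsf{B}\boldsymbol\Sigma^0_2$ is the scheme $$(\forall i<n)(\exists m)\,\varphi(i,n,m)\implies(\exists k)(\forall i<n)(\exists m<k)\,\varphi(i,n,m),$$ where $\varphi$ is any $\Sigma^0_2$ formula (possibly with number and set parameters), for every $n\in\mathbb{N}$. $\mathsf{FUF}$ is the statement: for every $n\in\mathbb{N}$ and every family $\{X_i : i<n\}$ of subsets of $\mathbb{N}$ (coded as a single set), $$(\forall i<n)(X_i\text{ is finite})\implies\bigcup_{i<n}X_i\text{ is finite}.$$ Here "$X$ is finite" means $(\exists m)(\forall x\in X)(x<m)$. *)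

theory Defs
  imports Main
begin

text \<open>
  The two-sorted language of second-order arithmetic. Number variables and set variables are
  both named by natural numbers but live in separate name spaces. As usual, equality is
  primitive for numbers only.
\<close>

datatype tm =
    Var nat
  | Zero  (\<open>\<^bold>0\<close>)
  | One  (\<open>\<^bold>1\<close>)
  | Plus tm tm  (infixl \<open>\<^bold>+\<close> 65)
  | Times tm tm  (infixl \<open>\<^bold>*\<close> 70)

datatype fm =
    Eq tm tm  (infix \<open>\<^bold>=\<close> 50)
  | Less tm tm  (infix \<open>\<^bold><\<close> 50)
  | Mem tm nat  (infix \<open>\<^bold>\<in>\<close> 50)
  | Neg fm  (\<open>\<^bold>\<not> _\<close> [40] 40)
  | Conj fm fm  (infixr \<open>\<^bold>\<and>\<close> 35)
  | Disj fm fm  (infixr \<open>\<^bold>\<or>\<close> 30)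
  | Impl fm fm  (infixr \<open>\<^bold>\<longrightarrow>\<close> 25)
  | AllN nat fm
  | ExN nat fm
  | AllS nat fm
  | ExS nat fm

definition Iff :: "fm \<Rightarrow> fm \<Rightarrow> fm"  (infixr \<open>\<^bold>\<longleftrightarrow>\<close> 25) where
  "(\<phi> \<^bold>\<longleftrightarrow> \<psi>) = ((\<phi> \<^bold>\<longrightarrow> \<psi>) \<^bold>\<and> (\<psi> \<^bold>\<longrightarrow> \<phi>))"

text \<open>Bounded quantifiers; they are only used when the variable does not occur in the bound.\<close>

definition AllB :: "nat \<Rightarrow> tm \<Rightarrow> fm \<Rightarrow> fm" where
  "AllB x t \<phi> = AllN x (Var x \<^bold>< t \<^bold>\<longrightarrow> \<phi>)"

definition ExB :: "nat \<Rightarrow> tm \<Rightarrow> fm \<Rightarrow> fm" where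
  "ExB x t \<phi> = ExN x (Var x \<^bold>< t \<^bold>\<and> \<phi>)"

primrec tm_vars :: "tm \<Rightarrow> nat set" where
  "tm_vars (Var x) = {x}"
| "tm_vars \<^bold>0 = {}"
| "tm_vars \<^bold>1 = {}"
| "tm_vars (s \<^bold>+ t) = tm_vars s \<union> tm_vars t"
| "tm_vars (s \<^bold>* t) = tm_vars s \<union> tm_vars t"

primrec free_num :: "fm \<Rightarrow> nat set" where
  "free_num (s \<^bold>= t) = tm_vars s \<union> tm_vars t"
| "free_num (s \<^bold>< t) = tm_vars s \<union> tm_vars t"
| "free_num (t \<^bold>\<in> X) = tm_vars t"
| "free_num (\<^bold>\<not> \<phi>) = free_num \<phi>"
| "free_num (\<phi> \<^bold>\<and> \<psi>) = free_num \<phi> \<union> free_num \<psi>"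
| "free_num (\<phi> \<^bold>\<or> \<psi>) = free_num \<phi> \<union> free_num \<psi>"
| "free_num (\<phi> \<^bold>\<longrightarrow> \<psi>) = free_num \<phi> \<union> free_num \<psi>"
| "free_num (AllN x \<phi>) = free_num \<phi> - {x}"
| "free_num (ExN x \<phi>) = free_num \<phi> - {x}"
| "free_num (AllS X \<phi>) = free_num \<phi>"
| "free_num (ExS X \<phi>) = free_num \<phi>"

primrec free_set :: "fm \<Rightarrow> nat set" where
  "free_set (s \<^bold>= t) = {}"
| "free_set (s \<^bold>< t) = {}"
| "free_set (t \<^bold>\<in> X) = {X}"
| "free_set (\<^bold>\<not> \<phi>) = free_set \<phi>"
| "free_set (\<phi> \<^bold>\<and> \<psi>) = free_set \<phi> \<union> free_set \<psi>"
| "free_set (\<phi> \<^bold>\<or> \<psi>) = free_set \<phi> \<union> free_set \<psi>"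
| "free_set (\<phi> \<^bold>\<longrightarrow> \<psi>) = free_set \<phi> \<union> free_set \<psi>"
| "free_set (AllN x \<phi>) = free_set \<phi>"
| "free_set (ExN x \<phi>) = free_set \<phi>"
| "free_set (AllS X \<phi>) = free_set \<phi> - {X}"
| "free_set (ExS X \<phi>) = free_set \<phi> - {X}"

text \<open>
  \<open>subst x t \<phi>\<close> replaces the free occurrences of \<open>x\<close> without renaming bound variables. It is
  only applied to terms \<open>t\<close> containing no variable other than \<open>x\<close>, so capture cannot occur.
\<close>

primrec subst_tm :: "nat \<Rightarrow> tm \<Rightarrow> tm \<Rightarrow> tm" where
  "subst_tm x t (Var y) = (if y = x then t else Var y)"
| "subst_tm x t \<^bold>0 = \<^bold>0"
| "subst_tm x t \<^bold>1 = \<^bold>1"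
| "subst_tm x t (r \<^bold>+ s) = subst_tm x t r \<^bold>+ subst_tm x t s"
| "subst_tm x t (r \<^bold>* s) = subst_tm x t r \<^bold>* subst_tm x t s"

primrec subst :: "nat \<Rightarrow> tm \<Rightarrow> fm \<Rightarrow> fm" where
  "subst x t (r \<^bold>= s) = (subst_tm x t r \<^bold>= subst_tm x t s)"
| "subst x t (r \<^bold>< s) = (subst_tm x t r \<^bold>< subst_tm x t s)"
| "subst x t (r \<^bold>\<in> X) = (subst_tm x t r \<^bold>\<in> X)"
| "subst x t (\<^bold>\<not> \<phi>) = (\<^bold>\<not> subst x t \<phi>)"
| "subst x t (\<phi> \<^bold>\<and> \<psi>) = (subst x t \<phi> \<^bold>\<and> subst x t \<psi>)"
| "subst x t (\<phi> \<^bold>\<or> \<psi>) = (subst x t \<phi> \<^bold>\<or> subst x t \<psi>)"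
| "subst x t (\<phi> \<^bold>\<longrightarrow> \<psi>) = (subst x t \<phi> \<^bold>\<longrightarrow> subst x t \<psi>)"
| "subst x t (AllN y \<phi>) = AllN y (if y = x then \<phi> else subst x t \<phi>)"
| "subst x t (ExN y \<phi>) = ExN y (if y = x then \<phi> else subst x t \<phi>)"
| "subst x t (AllS X \<phi>) = AllS X (subst x t \<phi>)"
| "subst x t (ExS X \<phi>) = ExS X (subst x t \<phi>)"


text \<open>
  Structures for this language, with Henkin (general) semantics: the number variables range over
  the type \<open>'a\<close> and the set variables over the collection \<open>set_dom\<close> of subsets of it. Symbols
  are interpreted arbitrarily; in particular \<open>'a\<close> need not be \<open>nat\<close>. With this semantics the
  language is an ordinary two-sorted first-order one, so that holding in all models of a theory
  amounts to being provable from it.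
\<close>

record 'a L2_struct =
  zero_of :: 'a
  one_of :: 'a
  plus_of :: "'a \<Rightarrow> 'a \<Rightarrow> 'a"
  times_of :: "'a \<Rightarrow> 'a \<Rightarrow> 'a"
  less_of :: "'a \<Rightarrow> 'a \<Rightarrow> bool"
  set_dom :: "'a set set"

definition is_L2_struct :: "'a L2_struct \<Rightarrow> bool" where
  "is_L2_struct M \<longleftrightarrow> set_dom M \<noteq> {}"

primrec val :: "'a L2_struct \<Rightarrow> (nat \<Rightarrow> 'a) \<Rightarrow> tm \<Rightarrow> 'a" where
  "val M e (Var x) = e x"
| "val M e \<^bold>0 = zero_of M"
| "val M e \<^bold>1 = one_of M"
| "val M e (s \<^bold>+ t) = plus_of M (val M e s) (val M e t)"
| "val M e (s \<^bold>* t) = times_of M (val M e s) (val M e t)"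

primrec sat :: "'a L2_struct \<Rightarrow> (nat \<Rightarrow> 'a) \<Rightarrow> (nat \<Rightarrow> 'a set) \<Rightarrow> fm \<Rightarrow> bool" where
  "sat M e E (s \<^bold>= t) \<longleftrightarrow> val M e s = val M e t"
| "sat M e E (s \<^bold>< t) \<longleftrightarrow> less_of M (val M e s) (val M e t)"
| "sat M e E (t \<^bold>\<in> X) \<longleftrightarrow> val M e t \<in> E X"
| "sat M e E (\<^bold>\<not> \<phi>) \<longleftrightarrow> \<not> sat M e E \<phi>"
| "sat M e E (\<phi> \<^bold>\<and> \<psi>) \<longleftrightarrow> sat M e E \<phi> \<and> sat M e E \<psi>"
| "sat M e E (\<phi> \<^bold>\<or> \<psi>) \<longleftrightarrow> sat M e E \<phi> \<or> sat M e E \<psi>"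
| "sat M e E (\<phi> \<^bold>\<longrightarrow> \<psi>) \<longleftrightarrow> (sat M e E \<phi> \<longrightarrow> sat M e E \<psi>)"
| "sat M e E (AllN x \<phi>) \<longleftrightarrow> (\<forall>a. sat M (e(x := a)) E \<phi>)"
| "sat M e E (ExN x \<phi>) \<longleftrightarrow> (\<exists>a. sat M (e(x := a)) E \<phi>)"
| "sat M e E (AllS X \<phi>) \<longleftrightarrow> (\<forall>A\<in>set_dom M. sat M e (E(X := A)) \<phi>)"
| "sat M e E (ExS X \<phi>) \<longleftrightarrow> (\<exists>A\<in>set_dom M. sat M e (E(X := A)) \<phi>)"

text \<open>
  A formula with free variables is true in a structure iff its universal closure is. This is how
  the schemes below admit arbitrary number and set parameters.
\<close>

definition true_in :: "'a L2_struct \<Rightarrow> fm \<Rightarrow> bool"  (infix \<open>\<Turnstile>\<close> 50) where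
  "M \<Turnstile> \<phi> \<longleftrightarrow> (\<forall>e E. range E \<subseteq> set_dom M \<longrightarrow> sat M e E \<phi>)"

definition model_of :: "'a L2_struct \<Rightarrow> fm set \<Rightarrow> bool"  (infix \<open>\<TTurnstile>\<close> 50) where
  "M \<TTurnstile> T \<longleftrightarrow> is_L2_struct M \<and> (\<forall>\<phi>\<in>T. M \<Turnstile> \<phi>)"


inductive_set Delta00 :: "fm set" where
  "(s \<^bold>= t) \<in> Delta00"
| "(s \<^bold>< t) \<in> Delta00"
| "(t \<^bold>\<in> X) \<in> Delta00"
| "\<phi> \<in> Delta00 \<Longrightarrow> (\<^bold>\<not> \<phi>) \<in> Delta00"
| "\<phi> \<in> Delta00 \<Longrightarrow> \<psi> \<in> Delta00 \<Longrightarrow> (\<phi> \<^bold>\<and> \<psi>) \<in> Delta00"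
| "\<phi> \<in> Delta00 \<Longrightarrow> \<psi> \<in> Delta00 \<Longrightarrow> (\<phi> \<^bold>\<or> \<psi>) \<in> Delta00"
| "\<phi> \<in> Delta00 \<Longrightarrow> \<psi> \<in> Delta00 \<Longrightarrow> (\<phi> \<^bold>\<longrightarrow> \<psi>) \<in> Delta00"
| "\<phi> \<in> Delta00 \<Longrightarrow> x \<notin> tm_vars t \<Longrightarrow> AllB x t \<phi> \<in> Delta00"
| "\<phi> \<in> Delta00 \<Longrightarrow> x \<notin> tm_vars t \<Longrightarrow> ExB x t \<phi> \<in> Delta00"

text \<open>
  The boldface classes \<open>\<Sigma>\<^sup>0\<^sub>k\<close> and \<open>\<Pi>\<^sup>0\<^sub>k\<close>: a prefix of exactly \<open>k\<close> alternating number quantifiers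
  in front of a bounded formula, set variables being allowed as parameters.
\<close>

fun Sigma0 :: "nat \<Rightarrow> fm set" and Pi0 :: "nat \<Rightarrow> fm set" where
  "Sigma0 0 = Delta00"
| "Sigma0 (Suc k) = {ExN x \<phi> | x \<phi>. \<phi> \<in> Pi0 k}"
| "Pi0 0 = Delta00"
| "Pi0 (Suc k) = {AllN x \<phi> | x \<phi>. \<phi> \<in> Sigma0 k}"


text \<open>The first-order theory of the nonnegative parts of discretely ordered rings.\<close>

definition discretely_ordered_semiring :: "fm set" where
  "discretely_ordered_semiring =
    (let x = Var 0; y = Var 1; z = Var 2 in
     {(x \<^bold>+ y) \<^bold>+ z \<^bold>= x \<^bold>+ (y \<^bold>+ z),
      x \<^bold>+ y \<^bold>= y \<^bold>+ x,
      (x \<^bold>* y) \<^bold>* z \<^bold>= x \<^bold>* (y \<^bold>* z),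
      x \<^bold>* y \<^bold>= y \<^bold>* x,
      x \<^bold>* (y \<^bold>+ z) \<^bold>= x \<^bold>* y \<^bold>+ x \<^bold>* z,
      x \<^bold>+ \<^bold>0 \<^bold>= x,
      x \<^bold>* \<^bold>0 \<^bold>= \<^bold>0,
      x \<^bold>* \<^bold>1 \<^bold>= x,
      (x \<^bold>< y \<^bold>\<and> y \<^bold>< z) \<^bold>\<longrightarrow> x \<^bold>< z,
      \<^bold>\<not> x \<^bold>< x,
      x \<^bold>< y \<^bold>\<or> x \<^bold>= y \<^bold>\<or> y \<^bold>< x,
      x \<^bold>< y \<^bold>\<longrightarrow> x \<^bold>+ z \<^bold>< y \<^bold>+ z,
      (\<^bold>0 \<^bold>< z \<^bold>\<and> x \<^bold>< y) \<^bold>\<longrightarrow> x \<^bold>* z \<^bold>< y \<^bold>* z,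
      x \<^bold>< y \<^bold>\<longrightarrow> ExN 2 (x \<^bold>+ z \<^bold>= y),
      \<^bold>0 \<^bold>< \<^bold>1,
      \<^bold>0 \<^bold>< x \<^bold>\<longrightarrow> (x \<^bold>= \<^bold>1 \<^bold>\<or> \<^bold>1 \<^bold>< x),
      x \<^bold>= \<^bold>0 \<^bold>\<or> \<^bold>0 \<^bold>< x})"

definition Sigma01_induction :: "fm set" where
  "Sigma01_induction =
    {(subst x \<^bold>0 \<phi> \<^bold>\<and> AllN x (\<phi> \<^bold>\<longrightarrow> subst x (Var x \<^bold>+ \<^bold>1) \<phi>)) \<^bold>\<longrightarrow> AllN x \<phi> | x \<phi>.
      \<phi> \<in> Sigma0 1}"

definition Delta01_comprehension :: "fm set" where
  "Delta01_comprehension =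
    {AllN x (\<phi> \<^bold>\<longleftrightarrow> \<psi>) \<^bold>\<longrightarrow> ExS X (AllN x (Var x \<^bold>\<in> X \<^bold>\<longleftrightarrow> \<phi>)) | x X \<phi> \<psi>.
      \<phi> \<in> Sigma0 1 \<and> \<psi> \<in> Pi0 1 \<and> X \<notin> free_set \<phi>}"

definition RCA0 :: "fm set" where
  "RCA0 = discretely_ordered_semiring \<union> Sigma01_induction \<union> Delta01_comprehension"


definition BSigma02 :: "fm set" where
  "BSigma02 =
    {AllB i (Var n) (ExN m \<phi>) \<^bold>\<longrightarrow> ExN k (AllB i (Var n) (ExB m (Var k) \<phi>)) | i n m k \<phi>.
      \<phi> \<in> Sigma0 2 \<and> distinct [i, n, m, k] \<and> k \<notin> free_num \<phi>}"

text \<open>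
  \<open>Fin x m \<chi>\<close> says that \<open>{x. \<chi>}\<close> is finite, i.e. bounded; \<open>m\<close> is a variable distinct from \<open>x\<close>
  and not free in \<open>\<chi>\<close>.
\<close>

definition Fin :: "nat \<Rightarrow> nat \<Rightarrow> fm \<Rightarrow> fm" where
  "Fin x m \<chi> = ExN m (AllN x (\<chi> \<^bold>\<longrightarrow> Var x \<^bold>< Var m))"

text \<open>
  A family of sets is coded by a single set \<open>X\<close> through the usual pairing polynomial
  \<open>(i + x)\<^sup>2 + i\<close>, which is injective over the axioms above: \<open>X\<^sub>i = {x. (i, x) \<in> X}\<close>.
\<close>

definition pair_tm :: "tm \<Rightarrow> tm \<Rightarrow> tm" where
  "pair_tm s t = (s \<^bold>+ t) \<^bold>* (s \<^bold>+ t) \<^bold>+ s"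

definition Mem_row :: "tm \<Rightarrow> nat \<Rightarrow> tm \<Rightarrow> fm" where
  "Mem_row t X s = (pair_tm s t \<^bold>\<in> X)"

definition FUF :: fm where
  "FUF =
    (let n = 0; i = 1; x = 2; m = 3; X = 0 in
     AllN n (AllS X
       (AllB i (Var n) (Fin x m (Mem_row (Var x) X (Var i))) \<^bold>\<longrightarrow>
        Fin x m (ExB i (Var n) (Mem_row (Var x) X (Var i))))))"

end

theory Submission
  imports Defs
begin

text \<open>
  Everything is argued inside one model \<open>M\<close> of \<open>RCA\<^sub>0\<close>, whose numbers need not be standard.

  Bounding gives finite unions at once: that \<open>m\<close> bounds \<open>X\<^sub>i\<close> is a \<open>\<Pi>\<^sup>0\<^sub>1\<close> property of \<open>i\<close> and \<open>m\<close>,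
  hence a \<open>\<Sigma>\<^sup>0\<^sub>2\<close> one, so the individual bounds all lie below some \<open>k\<close>, which bounds the union
  (\<open>BSigma02_imp_FUF\<close>).

  Conversely, suppose that every \<open>i < n\<close> has \<open>m\<close> and \<open>a\<close> with \<open>\<forall>b. \<theta>(i, m, a, b)\<close>, where \<open>\<theta>\<close> is
  bounded. A number \<open>s\<close> refutes \<open>q\<close> for \<open>i\<close> if \<open>q < s\<close> and each candidate pair \<open>m, a < q\<close> fails
  \<open>\<theta>\<close> at some \<open>b < s\<close>. Cutting off both witnesses at the same \<open>q\<close> makes coding \<open>(m, a)\<close> as one
  number unnecessary. Refutation is a bounded property which gets harder as \<open>q\<close> grows. Let
  \<open>X\<^sub>i\<close> consist of the \<open>s\<close> that are least in refuting some \<open>q\<close>; this family exists by \<open>\<Delta>\<^sup>0\<^sub>1\<close>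
  comprehension.

  Each \<open>X\<^sub>i\<close> is finite. Once \<open>q\<close> exceeds a true witness pair, it is never refuted. Since \<open>0\<close> is
  refuted by \<open>1\<close>, \<open>\<Sigma>\<^sup>0\<^sub>1\<close> induction on \<open>q\<close> yields a last refutable \<open>q\<^sub>0\<close>, and a number refuting \<open>q\<^sub>0\<close>
  refutes every refutable \<open>q\<close> and so bounds \<open>X\<^sub>i\<close>.

  By \<open>FUF\<close> some \<open>k\<close> lies above every element of every \<open>X\<^sub>i\<close>, and this \<open>k\<close> also bounds the witnesses.
  Otherwise, for some \<open>i\<close>, all pairs below \<open>k\<close> fail; by \<open>\<Sigma>\<^sup>0\<^sub>1\<close> bounding
  (\<open>Sigma1_bounding_pairs\<close>) one number refutes \<open>k\<close>, and the least such number is an element of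
  \<open>X\<^sub>i\<close> greater than \<open>k\<close>, a contradiction (\<open>FUF_imp_bounded_witnesses\<close>).
\<close>

section \<open>Coincidence and substitution\<close>

lemma val_cong: "\<forall>x\<in>tm_vars t. e x = e' x \<Longrightarrow> val M e t = val M e' t"
  by (induction t) auto

lemma sat_cong:
  assumes "\<forall>x\<in>free_num \<phi>. e x = e' x" and "\<forall>X\<in>free_set \<phi>. E X = E' X"
  shows "sat M e E \<phi> = sat M e' E' \<phi>"
  using assms
proof (induction \<phi> arbitrary: e e' E E')
  case (Eq s t)
  then show ?case using val_cong[of s e e'] val_cong[of t e e'] by simp
next
  case (Less s t)
  then show ?case using val_cong[of s e e'] val_cong[of t e e'] by simp
next
  case (Mem t X)
  then show ?case using val_cong[of t e e'] by simp
next
  case (Neg \<phi>)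
  then show ?case by simp
next
  case (Conj \<phi> \<psi>)
  from Conj.IH(1)[of e e' E E'] Conj.IH(2)[of e e' E E'] Conj.prems show ?case by simp
next
  case (Disj \<phi> \<psi>)
  from Disj.IH(1)[of e e' E E'] Disj.IH(2)[of e e' E E'] Disj.prems show ?case by simp
next
  case (Impl \<phi> \<psi>)
  from Impl.IH(1)[of e e' E E'] Impl.IH(2)[of e e' E E'] Impl.prems show ?case by simp
next
  case (AllN x \<phi>)
  have "sat M (e(x := a)) E \<phi> = sat M (e'(x := a)) E' \<phi>" for a
    by (rule AllN.IH) (use AllN.prems in auto)
  then show ?case by simp
next
  case (ExN x \<phi>)
  have "sat M (e(x := a)) E \<phi> = sat M (e'(x := a)) E' \<phi>" for a
    by (rule ExN.IH) (use ExN.prems in auto)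
  then show ?case by simp
next
  case (AllS X \<phi>)
  have "sat M e (E(X := A)) \<phi> = sat M e' (E'(X := A)) \<phi>" for A
    by (rule AllS.IH) (use AllS.prems in auto)
  then show ?case by simp
next
  case (ExS X \<phi>)
  have "sat M e (E(X := A)) \<phi> = sat M e' (E'(X := A)) \<phi>" for A
    by (rule ExS.IH) (use ExS.prems in auto)
  then show ?case by simp
qed

lemma val_subst_tm: "val M e (subst_tm x t s) = val M (e(x := val M e t)) s"
  by (induction s) auto

text \<open>
  No variable is renamed in the substitution, so the only way for it to go wrong is that a
  quantifier captures a variable of \<open>t\<close>. As \<open>x\<close> is the only one that may occur in \<open>t\<close>, a quantifier
  that could capture it leaves no free \<open>x\<close> to substitute for.
\<close>

lemma sat_subst:
  assumes "tm_vars t \<subseteq> {x}"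
  shows "sat M e E (subst x t \<phi>) = sat M (e(x := val M e t)) E \<phi>"
proof (induction \<phi> arbitrary: e E)
  case (AllN y \<phi>)
  show ?case
  proof (cases "y = x")
    case False
    then have "val M (e(y := a)) t = val M e t" for a
      using assms by (intro val_cong) auto
    then have "sat M (e(y := a)) E (subst x t \<phi>) = sat M (e(x := val M e t, y := a)) E \<phi>" for a
      by (simp only: AllN.IH fun_upd_twist[OF False])
    then show ?thesis using False by (simp only: subst.simps sat.simps if_False)
  qed (simp only: subst.simps sat.simps if_True refl fun_upd_upd)
next
  case (ExN y \<phi>)
  show ?case
  proof (cases "y = x")
    case False
    then have "val M (e(y := a)) t = val M e t" for a
      using assms by (intro val_cong) auto
    then have "sat M (e(y := a)) E (subst x t \<phi>) = sat M (e(x := val M e t, y := a)) E \<phi>" for a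
      by (simp only: ExN.IH fun_upd_twist[OF False])
    then show ?thesis using False by (simp only: subst.simps sat.simps if_False)
  qed (simp only: subst.simps sat.simps if_True refl fun_upd_upd)
qed (simp_all add: val_subst_tm)

lemma finite_tm_vars: "finite (tm_vars t)"
  by (induction t) auto

lemma finite_free_num: "finite (free_num \<phi>)"
  by (induction \<phi>) (auto simp: finite_tm_vars)

lemma finite_free_set: "finite (free_set \<phi>)"
  by (induction \<phi>) auto

lemma fresh_variable:
  assumes "finite (V :: nat set)"
  obtains x where "x \<notin> V"
  using ex_new_if_finite[OF infinite_UNIV_nat assms] by blast

lemma true_inD: "M \<Turnstile> \<phi> \<Longrightarrow> range E \<subseteq> set_dom M \<Longrightarrow> sat M e E \<phi>"
  by (simp only: true_in_def)

lemma sat_AllB: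
  "x \<notin> tm_vars t \<Longrightarrow>
    sat M e E (AllB x t \<phi>) \<longleftrightarrow> (\<forall>a. less_of M a (val M e t) \<longrightarrow> sat M (e(x := a)) E \<phi>)"
  using val_cong[of t "e(x := _)" e M] by (auto simp: AllB_def)

lemma sat_ExB:
  "x \<notin> tm_vars t \<Longrightarrow>
    sat M e E (ExB x t \<phi>) \<longleftrightarrow> (\<exists>a. less_of M a (val M e t) \<and> sat M (e(x := a)) E \<phi>)"
  using val_cong[of t "e(x := _)" e M] by (auto simp: ExB_def)

section \<open>Arithmetic in a model\<close>

locale RCA0_model =
  fixes M :: "'a L2_struct"
  assumes model: "M \<TTurnstile> RCA0"
begin

abbreviation zero (\<open>\<zero>\<close>) where "\<zero> \<equiv> zero_of M"
abbreviation one (\<open>\<one>\<close>) where "\<one> \<equiv> one_of M"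
abbreviation plus (infixl \<open>\<oplus>\<close> 65) where "x \<oplus> y \<equiv> plus_of M x y"
abbreviation times (infixl \<open>\<otimes>\<close> 70) where "x \<otimes> y \<equiv> times_of M x y"
abbreviation less (infix \<open>\<prec>\<close> 50) where "x \<prec> y \<equiv> less_of M x y"
abbreviation less_eq (infix \<open>\<preceq>\<close> 50) where "x \<preceq> y \<equiv> x \<prec> y \<or> x = y"

lemma set_dom_nonempty: "set_dom M \<noteq> {}"
  using model by (simp add: model_of_def is_L2_struct_def)

lemma true_axiom: "\<phi> \<in> RCA0 \<Longrightarrow> M \<Turnstile> \<phi>"
  using model by (simp add: model_of_def)

lemma semiring_axioms:
  shows add_commute: "x \<oplus> y = y \<oplus> x"
    and mult_commute: "x \<otimes> y = y \<otimes> x"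
    and distrib: "x \<otimes> (y \<oplus> z) = x \<otimes> y \<oplus> x \<otimes> z"
    and add_zero: "x \<oplus> \<zero> = x"
    and mult_zero: "x \<otimes> \<zero> = \<zero>"
    and mult_one: "x \<otimes> \<one> = x"
    and less_trans: "x \<prec> y \<Longrightarrow> y \<prec> z \<Longrightarrow> x \<prec> z"
    and less_irrefl: "\<not> x \<prec> x"
    and less_linear: "x \<prec> y \<or> x = y \<or> y \<prec> x"
    and add_strict_mono: "x \<prec> y \<Longrightarrow> x \<oplus> z \<prec> y \<oplus> z"
    and mult_strict_mono: "\<zero> \<prec> z \<Longrightarrow> x \<prec> y \<Longrightarrow> x \<otimes> z \<prec> y \<otimes> z"
    and less_imp_add: "x \<prec> y \<Longrightarrow> \<exists>w. x \<oplus> w = y"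
    and zero_less_one: "\<zero> \<prec> \<one>"
    and discrete: "\<zero> \<prec> x \<Longrightarrow> x = \<one> \<or> \<one> \<prec> x"
    and zero_or_pos: "x = \<zero> \<or> \<zero> \<prec> x"
proof -
  obtain A where A: "A \<in> set_dom M" using set_dom_nonempty by blast
  define e :: "nat \<Rightarrow> 'a" where "e = (\<lambda>_. \<zero>)(0 := x, Suc 0 := y, 2 := z)"
  have *: "sat M e (\<lambda>_. A) \<phi>" if "\<phi> \<in> discretely_ordered_semiring" for \<phi>
    using that A by (intro true_inD true_axiom) (auto simp: RCA0_def)
  have e: "e 0 = x" "e 1 = y" "e 2 = z" by (auto simp: e_def)
  then have upd: "(e(2 := w)) 0 = x" "(e(2 := w)) 1 = y" "(e(2 := w)) 2 = w" for w by auto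
  have "\<forall>\<phi>\<in>discretely_ordered_semiring. sat M e (\<lambda>_. A) \<phi>" using * by blast
  then have ax: "(x \<oplus> y) \<oplus> z = x \<oplus> (y \<oplus> z) \<and> x \<oplus> y = y \<oplus> x \<and> (x \<otimes> y) \<otimes> z = x \<otimes> (y \<otimes> z) \<and>
    x \<otimes> y = y \<otimes> x \<and> x \<otimes> (y \<oplus> z) = x \<otimes> y \<oplus> x \<otimes> z \<and> x \<oplus> \<zero> = x \<and> x \<otimes> \<zero> = \<zero> \<and> x \<otimes> \<one> = x \<and>
    (x \<prec> y \<and> y \<prec> z \<longrightarrow> x \<prec> z) \<and> \<not> x \<prec> x \<and> (x \<prec> y \<or> x = y \<or> y \<prec> x) \<and>
    (x \<prec> y \<longrightarrow> x \<oplus> z \<prec> y \<oplus> z) \<and> (\<zero> \<prec> z \<and> x \<prec> y \<longrightarrow> x \<otimes> z \<prec> y \<otimes> z) \<and>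
    (x \<prec> y \<longrightarrow> (\<exists>w. x \<oplus> w = y)) \<and> \<zero> \<prec> \<one> \<and> (\<zero> \<prec> x \<longrightarrow> x = \<one> \<or> \<one> \<prec> x) \<and> (x = \<zero> \<or> \<zero> \<prec> x)"
    unfolding discretely_ordered_semiring_def Let_def ball_simps sat.simps val.simps e upd
    by (elim conjE) (intro conjI; assumption)
  show "x \<oplus> y = y \<oplus> x" "x \<otimes> y = y \<otimes> x" "x \<otimes> (y \<oplus> z) = x \<otimes> y \<oplus> x \<otimes> z" "x \<oplus> \<zero> = x" "x \<otimes> \<zero> = \<zero>" "x \<otimes> \<one> = x"
    "x \<prec> y \<Longrightarrow> y \<prec> z \<Longrightarrow> x \<prec> z" "\<not> x \<prec> x" "x \<prec> y \<or> x = y \<or> y \<prec> x"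
    "x \<prec> y \<Longrightarrow> x \<oplus> z \<prec> y \<oplus> z" "\<zero> \<prec> z \<Longrightarrow> x \<prec> y \<Longrightarrow> x \<otimes> z \<prec> y \<otimes> z"
    "x \<prec> y \<Longrightarrow> \<exists>w. x \<oplus> w = y" "\<zero> \<prec> \<one>" "\<zero> \<prec> x \<Longrightarrow> x = \<one> \<or> \<one> \<prec> x" "x = \<zero> \<or> \<zero> \<prec> x"
    using ax by blast+
qed

sublocale ord: linorder "\<lambda>x y. x \<preceq> y" "\<lambda>x y. x \<prec> y"
  using less_trans less_irrefl less_linear by unfold_locales blast+

lemma not_less_zero: "\<not> x \<prec> \<zero>"
  using zero_or_pos less_trans less_irrefl by metis

lemma add_mono: "x \<preceq> y \<Longrightarrow> x \<oplus> z \<preceq> y \<oplus> z"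
  using add_strict_mono by blast

lemma mult_mono: "x \<preceq> y \<Longrightarrow> x \<otimes> z \<preceq> y \<otimes> z"
  using mult_strict_mono zero_or_pos mult_zero by metis

lemma le_add: "x \<preceq> y \<oplus> x"
  using add_mono[of \<zero> y x] zero_or_pos add_zero add_commute by metis

lemma less_Suc: "x \<prec> x \<oplus> \<one>"
  using add_strict_mono[OF zero_less_one, of x] add_zero add_commute by metis

lemma less_imp_Suc_le:
  assumes "x \<prec> y"
  shows "x \<oplus> \<one> \<preceq> y"
proof -
  obtain w where w: "x \<oplus> w = y" using less_imp_add[OF assms] by blast
  have "w \<noteq> \<zero>" using w assms add_zero less_irrefl by metis
  then have "\<one> \<preceq> w" using zero_or_pos discrete by blast
  from add_mono[OF this, of x] show ?thesis using w add_commute by metis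
qed

lemma less_Suc_iff: "x \<prec> y \<oplus> \<one> \<longleftrightarrow> x \<preceq> y"
  using less_imp_Suc_le[of y x] less_Suc[of y] less_trans[of x y "y \<oplus> \<one>"]
    less_linear[of x y] less_trans[of "y \<oplus> \<one>" x "y \<oplus> \<one>"] less_irrefl by metis

definition pair :: "'a \<Rightarrow> 'a \<Rightarrow> 'a" where
  "pair x y = (x \<oplus> y) \<otimes> (x \<oplus> y) \<oplus> x"

lemma val_pair_tm [simp]: "val M e (pair_tm s t) = pair (val M e s) (val M e t)"
  by (simp add: pair_tm_def pair_def)

lemma le_square: "x \<preceq> x \<otimes> x"
proof (cases "x = \<zero>")
  case False
  then have "\<one> \<preceq> x" using zero_or_pos discrete by blast
  from mult_mono[OF this, of x] show ?thesis using mult_commute mult_one by metis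
qed (simp add: mult_zero)

lemma fst_le_pair: "x \<preceq> pair x y"
  unfolding pair_def by (rule le_add)

lemma snd_le_pair: "y \<preceq> pair x y"
proof -
  have "y \<preceq> x \<oplus> y" by (rule le_add)
  from ord.order_trans[OF this le_square]
  have "y \<preceq> (x \<oplus> y) \<otimes> (x \<oplus> y)" .
  from ord.order_trans[OF this le_add[of _ x]] show ?thesis
    by (simp only: pair_def add_commute[of "(x \<oplus> y) \<otimes> (x \<oplus> y)"])
qed

text \<open>
  The square \<open>(x \<oplus> y)\<^sup>2\<close> leaves a gap of more than \<open>x \<oplus> y\<close> before the next one, so the
  sum of the components can be read off from the pair.
\<close>

lemma pair_less_pair:
  assumes "x \<oplus> y \<prec> x' \<oplus> y'"
  shows "pair x y \<prec> pair x' y'"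
proof -
  define u v where "u = x \<oplus> y" and "v = x' \<oplus> y'"
  have uv: "u \<prec> v" using assms by (simp add: u_def v_def)
  have "x \<preceq> u" unfolding u_def using le_add add_commute by metis
  from add_mono[OF this] have 1: "u \<otimes> u \<oplus> x \<preceq> u \<otimes> u \<oplus> u" using add_commute by metis
  have 2: "u \<otimes> u \<oplus> u = u \<otimes> (u \<oplus> \<one>)" by (simp only: distrib mult_one)
  have "\<zero> \<prec> u \<oplus> \<one>" unfolding less_Suc_iff using zero_or_pos by metis
  then have 3: "u \<otimes> (u \<oplus> \<one>) \<prec> v \<otimes> (u \<oplus> \<one>)" using uv by (rule mult_strict_mono)
  have 4: "v \<otimes> (u \<oplus> \<one>) \<preceq> v \<otimes> v" using mult_mono[OF less_imp_Suc_le[OF uv]] mult_commute by metis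
  have 5: "v \<otimes> v \<preceq> v \<otimes> v \<oplus> x'" using le_add add_commute by metis
  have "u \<otimes> u \<oplus> x \<prec> v \<otimes> v \<oplus> x'"
    using ord.less_le_trans[OF ord.le_less_trans[OF 1[unfolded 2] 3] ord.order_trans[OF 4 5]] .
  then show ?thesis by (simp only: pair_def u_def v_def)
qed

lemma pair_inject: "pair x y = pair x' y' \<longleftrightarrow> x = x' \<and> y = y'"
proof
  have cancel: "a = b" if "a \<oplus> c = b \<oplus> c" for a b c
    using that add_strict_mono less_irrefl less_linear by metis
  assume eq: "pair x y = pair x' y'"
  then have sum: "x \<oplus> y = x' \<oplus> y'"
    using pair_less_pair less_linear less_irrefl by metis
  then have "x = x'"
    using eq cancel unfolding pair_def by (metis add_commute)
  then show "x = x' \<and> y = y'"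
    using sum cancel by (metis add_commute)
qed simp

section \<open>Semantic forms of induction, comprehension and bounding\<close>

text \<open>
  Truth under an assignment makes parameters free of charge: they are whatever \<open>e\<close> and \<open>E\<close> fix.
\<close>

lemma Sigma1_induct:
  assumes E: "range E \<subseteq> set_dom M" and \<theta>: "\<theta> \<in> Delta00"
    and base: "\<exists>b. sat M (e(x := \<zero>, y := b)) E \<theta>"
    and step: "\<And>a. \<exists>b. sat M (e(x := a, y := b)) E \<theta> \<Longrightarrow> \<exists>b. sat M (e(x := a \<oplus> \<one>, y := b)) E \<theta>"
  shows "\<exists>b. sat M (e(x := a, y := b)) E \<theta>"
proof -
  let ?\<phi> = "ExN y \<theta>"
  have "?\<phi> \<in> Sigma0 1" using \<theta> by simp
  then have "M \<Turnstile> (subst x \<^bold>0 ?\<phi> \<^bold>\<and> AllN x (?\<phi> \<^bold>\<longrightarrow> subst x (Var x \<^bold>+ \<^bold>1) ?\<phi>) \<^bold>\<longrightarrow> AllN x ?\<phi>)"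
    by (intro true_axiom, unfold RCA0_def Sigma01_induction_def)
      (rule UnI1, rule UnI2, rule CollectI, intro exI conjI, rule refl, assumption)
  then have ind: "sat M e E (subst x \<^bold>0 ?\<phi> \<^bold>\<and> AllN x (?\<phi> \<^bold>\<longrightarrow> subst x (Var x \<^bold>+ \<^bold>1) ?\<phi>)) \<Longrightarrow>
      sat M e E (AllN x ?\<phi>)"
    using E by (simp only: true_in_def sat.simps(7))
  have 0: "sat M e E (subst x \<^bold>0 ?\<phi>)"
    using base by (simp only: sat_subst tm_vars.simps empty_subsetI val.simps sat.simps)
  have Suc: "sat M (e(x := a)) E ?\<phi> \<longrightarrow> sat M (e(x := a)) E (subst x (Var x \<^bold>+ \<^bold>1) ?\<phi>)" for a
    using step[of a]
    by (simp only: sat_subst tm_vars.simps Un_empty_right subset_refl val.simps sat.simps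
        fun_upd_same fun_upd_upd) blast
  have "sat M e E (subst x \<^bold>0 ?\<phi> \<^bold>\<and> AllN x (?\<phi> \<^bold>\<longrightarrow> subst x (Var x \<^bold>+ \<^bold>1) ?\<phi>))"
    unfolding sat.simps(5,7,8) using 0 Suc by (intro conjI allI)
  from ind[OF this] show ?thesis unfolding sat.simps(8,9) by (rule spec)
qed

text \<open>
  A bounded formula becomes both \<open>\<Sigma>\<^sup>0\<^sub>1\<close> and \<open>\<Pi>\<^sup>0\<^sub>1\<close> through a quantifier over a dummy variable.
\<close>

lemma Delta0_comprehension:
  assumes E: "range E \<subseteq> set_dom M" and \<theta>: "\<theta> \<in> Delta00"
  shows "{a. sat M (e(x := a)) E \<theta>} \<in> set_dom M"
proof -
  obtain d where d: "d \<notin> free_num \<theta>" using fresh_variable finite_free_num by blast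
  obtain X where X: "X \<notin> free_set \<theta>" using fresh_variable finite_free_set by blast
  let ?\<phi> = "ExN d \<theta>" and ?\<psi> = "AllN d \<theta>"
  have dummy: "sat M (e'(d := b)) E' \<theta> = sat M e' E' \<theta>" for e' E' b
    by (rule sat_cong) (use d in auto)
  have "?\<phi> \<in> Sigma0 1" "?\<psi> \<in> Pi0 1" "X \<notin> free_set ?\<phi>" using \<theta> X by simp_all
  then have "M \<Turnstile> (AllN x (?\<phi> \<^bold>\<longleftrightarrow> ?\<psi>) \<^bold>\<longrightarrow> ExS X (AllN x (Var x \<^bold>\<in> X \<^bold>\<longleftrightarrow> ?\<phi>)))"
    by (intro true_axiom, unfold RCA0_def Delta01_comprehension_def)
      (rule UnI2, rule CollectI, intro exI conjI, rule refl, simp_all only:)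
  then have "sat M e E (AllN x (?\<phi> \<^bold>\<longleftrightarrow> ?\<psi>)) \<Longrightarrow> sat M e E (ExS X (AllN x (Var x \<^bold>\<in> X \<^bold>\<longleftrightarrow> ?\<phi>)))"
    using E by (simp only: true_in_def sat.simps(7))
  moreover have "sat M e E (AllN x (?\<phi> \<^bold>\<longleftrightarrow> ?\<psi>))"
    by (simp only: Iff_def sat.simps dummy) blast
  ultimately have "\<exists>A\<in>set_dom M. \<forall>a. a \<in> A \<longleftrightarrow> sat M (e(x := a)) (E(X := A)) \<theta>"
    by (simp add: Iff_def dummy) blast
  then obtain A where A: "A \<in> set_dom M"
    and mem: "\<And>a. a \<in> A \<longleftrightarrow> sat M (e(x := a)) (E(X := A)) \<theta>"
    by blast
  have "sat M e' (E(X := A)) \<theta> = sat M e' E \<theta>" for e'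
    by (rule sat_cong) (use X in auto)
  then have "A = {a. sat M (e(x := a)) E \<theta>}" using mem by blast
  with A show ?thesis by (simp only:)
qed

text \<open>
  If there were no least solution, then induction on \<open>u\<close> would show that there is no solution
  below \<open>u\<close>; this is a bounded statement about \<open>u\<close>.
\<close>

lemma Delta0_least:
  assumes E: "range E \<subseteq> set_dom M" and \<theta>: "\<theta> \<in> Delta00"
    and ex: "sat M (e(x := a)) E \<theta>"
  obtains a where "sat M (e(x := a)) E \<theta>" and "\<And>b. b \<prec> a \<Longrightarrow> \<not> sat M (e(x := b)) E \<theta>"
proof (rule ccontr)
  assume "\<not> thesis"
  with that have none: "\<exists>b. b \<prec> a \<and> sat M (e(x := b)) E \<theta>" if "sat M (e(x := a)) E \<theta>" for a
    using \<open>sat M (e(x := a)) E \<theta>\<close> by blast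
  obtain u where u: "u \<notin> insert x (free_num \<theta>)"
    using fresh_variable[of "insert x (free_num \<theta>)"] finite_free_num by blast
  obtain d where d: "d \<notin> insert u (insert x (free_num \<theta>))"
    using fresh_variable[of "insert u (insert x (free_num \<theta>))"] finite_free_num by blast
  let ?\<theta> = "AllB x (Var u) (\<^bold>\<not> \<theta>)"
  have sat: "sat M (e(u := c, d := b)) E ?\<theta> \<longleftrightarrow> (\<forall>a. a \<prec> c \<longrightarrow> \<not> sat M (e(x := a)) E \<theta>)" for c b
  proof -
    have "sat M (e(u := c, d := b, x := a)) E \<theta> = sat M (e(x := a)) E \<theta>" for a
      by (rule sat_cong) (use u d in auto)
    with u d show ?thesis by (simp add: sat_AllB)
  qed
  have "\<exists>b. sat M (e(u := c, d := b)) E ?\<theta>" for c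
  proof (rule Sigma1_induct[OF E])
    show "?\<theta> \<in> Delta00" using \<theta> u by (auto intro!: Delta00.intros)
  qed (use none in \<open>simp_all add: sat not_less_zero less_Suc_iff\<close>, blast)
  then show False using sat none ex by blast
qed

text \<open>
  Induction on \<open>l\<close> shows that a common bound exists for the witnesses of all \<open>a\<close> below both \<open>l\<close>
  and \<open>c\<close>. The second restriction keeps the induction going past \<open>c\<close>, where witnesses may fail to
  exist.
\<close>

lemma Sigma1_bounding:
  assumes E: "range E \<subseteq> set_dom M" and \<theta>: "\<theta> \<in> Delta00"
    and ex: "\<And>a. a \<prec> c \<Longrightarrow> \<exists>b. sat M (e(x := a, y := b)) E \<theta>"
  shows "\<exists>d. \<forall>a. a \<prec> c \<longrightarrow> (\<exists>b. b \<prec> d \<and> sat M (e(x := a, y := b)) E \<theta>)"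
proof -
  let ?V = "insert x (insert y (free_num \<theta>))"
  obtain k where k: "k \<notin> ?V"
    using fresh_variable[of ?V] finite_free_num by blast
  obtain u where u: "u \<notin> insert k ?V"
    using fresh_variable[of "insert k ?V"] finite_free_num by blast
  obtain z where z: "z \<notin> insert u (insert k ?V)"
    using fresh_variable[of "insert u (insert k ?V)"] finite_free_num by blast
  define e' where "e' = e(k := c)"
  let ?\<theta> = "AllB x (Var u) (Var x \<^bold>< Var k \<^bold>\<longrightarrow> ExB y (Var z) \<theta>)"
  have sat: "sat M (e'(u := l, z := d)) E ?\<theta> \<longleftrightarrow>
    (\<forall>a. a \<prec> l \<longrightarrow> a \<prec> c \<longrightarrow> (\<exists>b. b \<prec> d \<and> sat M (e(x := a, y := b)) E \<theta>))" for l d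
  proof -
    have "sat M (e(k := c, u := l, z := d, x := a, y := b)) E \<theta> = sat M (e(x := a, y := b)) E \<theta>" for a b
      by (rule sat_cong) (use k u z in auto)
    with k u z show ?thesis by (simp add: sat_AllB sat_ExB e'_def)
  qed
  have "\<exists>d. sat M (e'(u := l, z := d)) E ?\<theta>" for l
  proof (rule Sigma1_induct[OF E])
    show "?\<theta> \<in> Delta00" using \<theta> k u z by (auto intro!: Delta00.intros)
    show "\<exists>d. sat M (e'(u := \<zero>, z := d)) E ?\<theta>" by (simp add: sat not_less_zero)
    fix l assume "\<exists>d. sat M (e'(u := l, z := d)) E ?\<theta>"
    then obtain d where d: "\<And>a. a \<prec> l \<Longrightarrow> a \<prec> c \<Longrightarrow> \<exists>b. b \<prec> d \<and> sat M (e(x := a, y := b)) E \<theta>"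
      unfolding sat by blast
    obtain b where b: "l \<prec> c \<Longrightarrow> sat M (e(x := l, y := b)) E \<theta>" using ex by blast
    \<comment> \<open>a common strict upper bound of the old bound and the new witness\<close>
    define d' where "d' = d \<oplus> (b \<oplus> \<one>)"
    have "d \<preceq> d'" unfolding d'_def using le_add add_commute by metis
    moreover have "b \<prec> d'" unfolding d'_def using le_add less_Suc less_trans by metis
    ultimately have "\<exists>b. b \<prec> d' \<and> sat M (e(x := a, y := b)) E \<theta>" if "a \<preceq> l" "a \<prec> c" for a
      using that d[of a] b less_trans by blast
    then have "sat M (e'(u := l \<oplus> \<one>, z := d')) E ?\<theta>"
      unfolding sat less_Suc_iff by blast
    then show "\<exists>d. sat M (e'(u := l \<oplus> \<one>, z := d)) E ?\<theta>" by blast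
  qed
  then obtain d where "sat M (e'(u := c, z := d)) E ?\<theta>" by blast
  then show ?thesis unfolding sat by blast
qed

text \<open>
  Bounding is applied twice: first to \<open>a'\<close> for each fixed \<open>a\<close>, then to the bounds so obtained,
  since being such a bound is again a bounded property.
\<close>

lemma Sigma1_bounding_pairs:
  assumes E: "range E \<subseteq> set_dom M" and \<theta>: "\<theta> \<in> Delta00"
    and ex: "\<And>a a'. a \<prec> c \<Longrightarrow> a' \<prec> c \<Longrightarrow> \<exists>b. sat M (e(x := a, x' := a', y := b)) E \<theta>"
  shows "\<exists>d. \<forall>a. a \<prec> c \<longrightarrow>
    (\<forall>a'. a' \<prec> c \<longrightarrow> (\<exists>b. b \<prec> d \<and> sat M (e(x := a, x' := a', y := b)) E \<theta>))"
proof -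
  let ?V = "{x, x', y} \<union> free_num \<theta>"
  have fin: "finite ?V" using finite_free_num by simp
  obtain k where k: "k \<notin> ?V" using fresh_variable[OF fin] .
  obtain z where z: "z \<notin> insert k ?V" using fresh_variable[of "insert k ?V"] fin by blast
  let ?rows = "AllB x' (Var k) (ExB y (Var z) \<theta>)"
  have sat: "sat M (e(k := c, x := a, z := d)) E ?rows \<longleftrightarrow>
    (\<forall>a'. a' \<prec> c \<longrightarrow> (\<exists>b. b \<prec> d \<and> sat M (e(x := a, x' := a', y := b)) E \<theta>))" for a d
  proof -
    have "sat M (e(k := c, x := a, z := d, x' := a', y := b)) E \<theta> =
      sat M (e(x := a, x' := a', y := b)) E \<theta>" for a' b
      by (rule sat_cong) (use k z in auto)
    with k z show ?thesis by (auto simp: sat_AllB sat_ExB)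
  qed
  have "?rows \<in> Delta00" using \<theta> k z by (auto intro!: Delta00.intros)
  moreover have "\<exists>d. sat M (e(k := c, x := a, z := d)) E ?rows" if "a \<prec> c" for a
    unfolding sat using Sigma1_bounding[OF E \<theta>, of c "e(x := a)" x' y] ex that by blast
  ultimately obtain w where w: "\<And>a. a \<prec> c \<Longrightarrow> \<exists>d. d \<prec> w \<and>
      (\<forall>a'. a' \<prec> c \<longrightarrow> (\<exists>b. b \<prec> d \<and> sat M (e(x := a, x' := a', y := b)) E \<theta>))"
    using Sigma1_bounding[OF E, of ?rows c "e(k := c)" x z] unfolding sat by blast
  have "\<exists>b. b \<prec> w \<and> sat M (e(x := a, x' := a', y := b)) E \<theta>" if "a \<prec> c" "a' \<prec> c" for a a'
    using w[OF that(1)] that(2) less_trans by blast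
  then show ?thesis by blast
qed

lemma FUF_iff:
  "M \<Turnstile> FUF \<longleftrightarrow> (\<forall>n. \<forall>A\<in>set_dom M.
     (\<forall>i. i \<prec> n \<longrightarrow> (\<exists>m. \<forall>x. pair i x \<in> A \<longrightarrow> x \<prec> m)) \<longrightarrow>
     (\<exists>m. \<forall>x. (\<exists>i. i \<prec> n \<and> pair i x \<in> A) \<longrightarrow> x \<prec> m))"
proof -
  obtain A where "A \<in> set_dom M" using set_dom_nonempty by blast
  then have "\<exists>E :: nat \<Rightarrow> 'a set. range E \<subseteq> set_dom M" by (intro exI[of _ "\<lambda>_::nat. A"]) auto
  then show ?thesis
    by (auto simp: true_in_def FUF_def Let_def sat_AllB sat_ExB Fin_def Mem_row_def)
qed

section \<open>Bounding gives finite unions\<close>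

lemma BSigma02_imp_FUF:
  assumes "M \<TTurnstile> BSigma02"
  shows "M \<Turnstile> FUF"
  unfolding FUF_iff
proof (intro allI ballI impI)
  fix n A assume A: "A \<in> set_dom M"
    and rows: "\<forall>i. i \<prec> n \<longrightarrow> (\<exists>m. \<forall>x. pair i x \<in> A \<longrightarrow> x \<prec> m)"
  \<comment> \<open>the dummy quantifier over variable 5 turns the \<open>\<Pi>\<^sup>0\<^sub>1\<close> formula into a \<open>\<Sigma>\<^sup>0\<^sub>2\<close> one\<close>
  let ?\<phi> = "ExN 5 (AllN 2 (Mem_row (Var 2) 0 (Var 1) \<^bold>\<longrightarrow> Var 2 \<^bold>< Var 3))"
  have "?\<phi> \<in> Sigma0 2"
    by (auto simp: numeral_2_eq_2 Mem_row_def intro!: Delta00.intros)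
  moreover have "4 \<notin> free_num ?\<phi>" by (simp add: Mem_row_def pair_tm_def)
  ultimately have "(AllB 1 (Var 0) (ExN 3 ?\<phi>) \<^bold>\<longrightarrow> ExN 4 (AllB 1 (Var 0) (ExB 3 (Var 4) ?\<phi>))) \<in> BSigma02"
    unfolding BSigma02_def by fastforce
  then have "sat M (\<lambda>_. n) (\<lambda>_. A) (AllB 1 (Var 0) (ExN 3 ?\<phi>) \<^bold>\<longrightarrow> ExN 4 (AllB 1 (Var 0) (ExB 3 (Var 4) ?\<phi>)))"
    using assms A by (intro true_inD) (simp_all add: model_of_def)
  with rows obtain k where k: "\<And>i. i \<prec> n \<Longrightarrow> \<exists>m. m \<prec> k \<and> (\<forall>x. pair i x \<in> A \<longrightarrow> x \<prec> m)"
    by (auto simp: sat_AllB sat_ExB Mem_row_def)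
  then have "\<forall>x. (\<exists>i. i \<prec> n \<and> pair i x \<in> A) \<longrightarrow> x \<prec> k"
    using less_trans by blast
  then show "\<exists>m. \<forall>x. (\<exists>i. i \<prec> n \<and> pair i x \<in> A) \<longrightarrow> x \<prec> m" by blast
qed

section \<open>Finite unions give bounding\<close>

text \<open>
  The variables \<open>i\<close>, \<open>m\<close>, \<open>a\<close>, \<open>b\<close> may coincide, as the bound variables of a \<open>\<Sigma>\<^sup>0\<^sub>2\<close> formula are
  arbitrary; the order of the updates says which value then counts.
\<close>

lemma FUF_imp_bounded_witnesses:
  assumes FUF: "M \<Turnstile> FUF" and E: "range E \<subseteq> set_dom M" and \<theta>: "\<theta> \<in> Delta00"
    and wit: "\<And>iv. iv \<prec> c \<Longrightarrow> \<exists>mv av. \<forall>bv. sat M (e(i := iv, m := mv, a := av, b := bv)) E \<theta>"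
  shows "\<exists>kv. \<forall>iv. iv \<prec> c \<longrightarrow>
    (\<exists>mv av. mv \<prec> kv \<and> (\<forall>bv. sat M (e(i := iv, m := mv, a := av, b := bv)) E \<theta>))"
proof -
  let ?V = "{i, m, a, b} \<union> free_num \<theta>"
  have fin: "finite ?V" using finite_free_num by simp
  obtain q where q: "q \<notin> ?V" using fresh_variable[OF fin] .
  obtain s where s: "s \<notin> insert q ?V" using fresh_variable[of "insert q ?V"] fin by blast
  obtain t where t: "t \<notin> insert s (insert q ?V)"
    using fresh_variable[of "insert s (insert q ?V)"] fin by blast
  obtain y where y: "y \<notin> insert t (insert s (insert q ?V))"
    using fresh_variable[of "insert t (insert s (insert q ?V))"] fin by blast
  note fresh = q s t y

  define \<Theta> where "\<Theta> iv mv av bv \<longleftrightarrow> sat M (e(i := iv, m := mv, a := av, b := bv)) E \<theta>" for iv mv av bv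
  define refuted where "refuted iv qv sv \<longleftrightarrow> qv \<prec> sv \<and>
    (\<forall>mv. mv \<prec> qv \<longrightarrow> (\<forall>av. av \<prec> qv \<longrightarrow> (\<exists>bv. bv \<prec> sv \<and> \<not> \<Theta> iv mv av bv)))" for iv qv sv
  define refuted_fm where "refuted_fm v = (Var q \<^bold>< Var v \<^bold>\<and>
    AllB m (Var q) (AllB a (Var q) (ExB b (Var v) (\<^bold>\<not> \<theta>))))" for v
  have refuted_fm: "refuted_fm v \<in> Delta00" if "v \<in> {s, t}" for v
    using that \<theta> fresh unfolding refuted_fm_def by (auto intro!: Delta00.intros)
  have sat_refuted: "sat M e' E (refuted_fm v) \<longleftrightarrow> refuted (e' i) (e' q) (e' v)"
    if "v \<in> {s, t}" and "\<And>x. x \<in> ?V - {i, m, a, b} \<Longrightarrow> e' x = e x" for e' v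
  proof -
    have "sat M (e'(m := mv, a := av, b := bv)) E \<theta> = \<Theta> (e' i) mv av bv" for mv av bv
      unfolding \<Theta>_def by (rule sat_cong) (use that in auto)
    with that(1) fresh show ?thesis
      by (auto simp: refuted_fm_def refuted_def sat_AllB sat_ExB)
  qed
  have refuted_antimono: "refuted iv qv' sv" if "refuted iv qv sv" "qv' \<preceq> qv" for iv qv qv' sv
    using that less_trans unfolding refuted_def by metis

  define row where "row iv sv \<longleftrightarrow>
    (\<exists>qv. qv \<prec> sv \<and> refuted iv qv sv \<and> (\<forall>tv. tv \<prec> sv \<longrightarrow> \<not> refuted iv qv tv))" for iv sv
  define row_fm where "row_fm = ExB q (Var s) (refuted_fm s \<^bold>\<and> AllB t (Var s) (\<^bold>\<not> refuted_fm t))"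
  have row_fm: "row_fm \<in> Delta00"
    using refuted_fm fresh unfolding row_fm_def by (auto intro!: Delta00.intros)
  have sat_row: "sat M e' E row_fm \<longleftrightarrow> row (e' i) (e' s)"
    if "\<And>x. x \<in> ?V - {i, m, a, b} \<Longrightarrow> e' x = e x" for e'
  proof -
    have "i \<noteq> q" "i \<noteq> t" "s \<noteq> q" "q \<noteq> t" "s \<noteq> t" using fresh by auto
    moreover have "sat M (e'(q := qv)) E (refuted_fm s) \<longleftrightarrow> refuted (e' i) qv (e' s)" for qv
      by (subst sat_refuted) (use that fresh in auto)
    moreover have "sat M (e'(q := qv, t := tv)) E (refuted_fm t) \<longleftrightarrow> refuted (e' i) qv tv" for qv tv
      by (subst sat_refuted) (use that fresh in auto)
    ultimately show ?thesis
      unfolding row_fm_def row_def by (simp add: sat_AllB sat_ExB)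
  qed

  \<comment> \<open>both components of a pair are at most the pair, so decoding needs only bounded quantifiers\<close>
  let ?code = "ExB i (Var y \<^bold>+ \<^bold>1) (ExB s (Var y \<^bold>+ \<^bold>1) (Var y \<^bold>= pair_tm (Var i) (Var s) \<^bold>\<and> row_fm))"
  define A where "A = {yv. sat M (e(y := yv)) E ?code}"
  have "?code \<in> Delta00" using row_fm fresh by (auto intro!: Delta00.intros)
  then have A: "A \<in> set_dom M" unfolding A_def by (rule Delta0_comprehension[OF E])
  have mem_A: "pair iv sv \<in> A \<longleftrightarrow> row iv sv" for iv sv
  proof -
    have "sat M (e(y := yv, i := iv, s := sv)) E row_fm \<longleftrightarrow> row iv sv" for yv iv sv
      by (subst sat_row) (use fresh in auto)
    moreover have "i \<noteq> y" "s \<noteq> y" "i \<noteq> s" using fresh by auto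
    ultimately have "yv \<in> A \<longleftrightarrow> (\<exists>iv. iv \<preceq> yv \<and> (\<exists>sv. sv \<preceq> yv \<and> yv = pair iv sv \<and> row iv sv))" for yv
      by (simp add: A_def sat_ExB less_Suc_iff)
    then show ?thesis using fst_le_pair snd_le_pair pair_inject by metis
  qed

  \<comment> \<open>Each row is finite.\<close>
  have "\<exists>B. \<forall>sv. row iv sv \<longrightarrow> sv \<prec> B" if iv: "iv \<prec> c" for iv
  proof -
    obtain mv av where true_wit: "\<And>bv. \<Theta> iv mv av bv"
      using wit[OF iv] unfolding \<Theta>_def by blast
    \<comment> \<open>a number above both witnesses, hence never refuted\<close>
    define p where "p = (mv \<oplus> av) \<oplus> \<one>"
    have "mv \<prec> p" "av \<prec> p"
      unfolding p_def less_Suc_iff using le_add add_commute by metis+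
    then have p: "\<not> refuted iv p sv" for sv
      using true_wit unfolding refuted_def by blast
    have sat: "sat M (e(i := iv, q := qv, s := sv)) E (refuted_fm s) \<longleftrightarrow> refuted iv qv sv" for qv sv
      by (subst sat_refuted) (use fresh in auto)
    have "\<exists>qv. (\<exists>sv. refuted iv qv sv) \<and> (\<forall>sv. \<not> refuted iv (qv \<oplus> \<one>) sv)"
    proof (rule ccontr)
      assume *: "\<not> ?thesis"
      have "\<exists>sv. sat M (e(i := iv, q := p, s := sv)) E (refuted_fm s)"
      proof (rule Sigma1_induct[OF E refuted_fm])
        have "refuted iv \<zero> \<one>" by (simp add: refuted_def zero_less_one not_less_zero)
        then show "\<exists>sv. sat M (e(i := iv, q := \<zero>, s := sv)) E (refuted_fm s)" unfolding sat by blast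
      qed (use * in \<open>simp_all add: sat\<close>, blast)
      with p show False unfolding sat by blast
    qed
    then obtain q0 B where B: "refuted iv q0 B" and last: "\<And>sv. \<not> refuted iv (q0 \<oplus> \<one>) sv" by blast
    have "sv \<preceq> B" if in_row: "row iv sv" for sv
    proof -
      obtain qv where qv: "refuted iv qv sv" and least: "\<And>tv. tv \<prec> sv \<Longrightarrow> \<not> refuted iv qv tv"
        using in_row unfolding row_def by blast
      have "qv \<preceq> q0"
        using refuted_antimono[OF qv less_imp_Suc_le] last less_linear[of qv q0] by blast
      with B have "refuted iv qv B" by (rule refuted_antimono)
      with least show ?thesis using less_linear[of sv B] by blast
    qed
    then have "\<forall>sv. row iv sv \<longrightarrow> sv \<prec> B \<oplus> \<one>" unfolding less_Suc_iff by blast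
    then show ?thesis by blast
  qed
  then have "\<exists>kv. \<forall>sv. (\<exists>iv. iv \<prec> c \<and> row iv sv) \<longrightarrow> sv \<prec> kv"
    using FUF[unfolded FUF_iff, rule_format, OF A, of c] unfolding mem_A by blast
  then obtain kv where kv: "\<And>iv sv. iv \<prec> c \<Longrightarrow> row iv sv \<Longrightarrow> sv \<prec> kv" by blast

  \<comment> \<open>A bound for the union of the rows also bounds the witnesses.\<close>
  have "\<exists>mv av. mv \<prec> kv \<and> (\<forall>bv. \<Theta> iv mv av bv)" if iv: "iv \<prec> c" for iv
  proof (rule ccontr)
    assume none: "\<not> ?thesis"
    have neg_sat: "sat M (e(i := iv, m := mv, a := av, b := bv)) E (\<^bold>\<not> \<theta>) \<longleftrightarrow> \<not> \<Theta> iv mv av bv" for mv av bv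
      by (simp only: \<Theta>_def sat.simps)
    have "(\<^bold>\<not> \<theta>) \<in> Delta00" using \<theta> by (rule Delta00.intros)
    moreover have "\<exists>bv. sat M (e(i := iv, m := mv, a := av, b := bv)) E (\<^bold>\<not> \<theta>)" if "mv \<prec> kv" for mv av
      unfolding neg_sat using none that by blast
    ultimately obtain w where
      w: "\<forall>mv. mv \<prec> kv \<longrightarrow> (\<forall>av. av \<prec> kv \<longrightarrow> (\<exists>bv. bv \<prec> w \<and> \<not> \<Theta> iv mv av bv))"
      using Sigma1_bounding_pairs[OF E, of "\<^bold>\<not> \<theta>" kv "e(i := iv)" m a b] unfolding neg_sat by blast
    \<comment> \<open>refuting \<open>kv\<close> also takes a number above \<open>kv\<close>; this puts the least one beyond all rows\<close>
    define w' where "w' = w \<oplus> (kv \<oplus> \<one>)"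
    have "w \<preceq> w'" unfolding w'_def using le_add add_commute by metis
    moreover have "kv \<prec> w'" unfolding w'_def using le_add less_Suc less_trans by metis
    ultimately have "refuted iv kv w'"
      unfolding refuted_def using w less_trans by blast
    have sat: "sat M (e(i := iv, q := kv, s := sv)) E (refuted_fm s) \<longleftrightarrow> refuted iv kv sv" for sv
      by (subst sat_refuted) (use fresh in auto)
    obtain sv where sv: "refuted iv kv sv" "\<And>tv. tv \<prec> sv \<Longrightarrow> \<not> refuted iv kv tv"
      using Delta0_least[OF E refuted_fm, of s "e(i := iv, q := kv)" s w'] \<open>refuted iv kv w'\<close>
      unfolding sat by blast
    then have "kv \<prec> sv" unfolding refuted_def by blast
    with sv have "row iv sv" unfolding row_def by blast
    then have "sv \<prec> kv" using kv iv by blast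
    with \<open>kv \<prec> sv\<close> show False using less_trans less_irrefl by blast
  qed
  then show ?thesis unfolding \<Theta>_def by blast
qed

lemma FUF_imp_BSigma02:
  assumes "M \<Turnstile> FUF"
  shows "M \<TTurnstile> BSigma02"
  unfolding model_of_def
proof (intro conjI ballI)
  show "is_L2_struct M" using model by (simp add: model_of_def)
  fix \<chi> assume "\<chi> \<in> BSigma02"
  then obtain i n m k \<phi> where \<chi>: "\<chi> = (AllB i (Var n) (ExN m \<phi>) \<^bold>\<longrightarrow> ExN k (AllB i (Var n) (ExB m (Var k) \<phi>)))"
    and \<phi>: "\<phi> \<in> Sigma0 2" and dist: "distinct [i, n, m, k]" and k: "k \<notin> free_num \<phi>"
    unfolding BSigma02_def by blast
  from \<phi> obtain a b \<theta> where \<phi>_eq: "\<phi> = ExN a (AllN b \<theta>)" and \<theta>: "\<theta> \<in> Delta00"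
    by (auto simp: numeral_2_eq_2)
  show "M \<Turnstile> \<chi>"
    unfolding true_in_def
  proof (intro allI impI)
    fix e and E :: "nat \<Rightarrow> 'a set" assume E: "range E \<subseteq> set_dom M"
    have "sat M (e(k := kv, i := iv, m := mv)) E \<phi> = sat M (e(i := iv, m := mv)) E \<phi>" for kv iv mv
      by (rule sat_cong) (use k in auto)
    then have "sat M e E \<chi> \<longleftrightarrow>
      ((\<forall>iv. iv \<prec> e n \<longrightarrow> (\<exists>mv. sat M (e(i := iv, m := mv)) E \<phi>)) \<longrightarrow>
       (\<exists>kv. \<forall>iv. iv \<prec> e n \<longrightarrow> (\<exists>mv. mv \<prec> kv \<and> sat M (e(i := iv, m := mv)) E \<phi>)))"
      using dist by (simp add: \<chi> sat_AllB sat_ExB)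
    then show "sat M e E \<chi>"
      using FUF_imp_bounded_witnesses[OF assms E \<theta>, of "e n" e i m a b]
      unfolding \<phi>_eq by auto
  qed
qed

end

theorem lemma2p1:
  fixes M :: "'a L2_struct"
  assumes "M \<TTurnstile> RCA0"
  shows "M \<TTurnstile> BSigma02 \<longleftrightarrow> M \<Turnstile> FUF"
proof -
  interpret RCA0_model M by unfold_locales (rule assms)
  show ?thesis using BSigma02_imp_FUF FUF_imp_BSigma02 by blast
qed

end
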